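(* Let $(\mathcal{X},d)$ be a complete metric space, let $f\colon\mathcal{X}\to\mathbb{R}\cup\{+\infty\}$ be a closed function, and let $x\in\mathcal{X}$ be a point with $f(x)$ finite. Let $S\subseteq\mathcal{X}$ be an arbitrary set and let $x^*\in S$ be a point such that, for some constants $L>0$ and $\gamma>0$, the slope error-bound $$\operatorname{dist}(u;S)\leq L\cdot|\nabla f|(u)\quad\text{for all } u\in\mathbf{B}_\gamma(x^* )$$ holds. Let $f_x\colon\mathcal{X}\to\mathbb{R}\cup\{+\infty\}$ be a closed function such that for some $\eta>0$ $$|f_x(y)-f(y)|\leq\frac{\eta}{2}d^2(y,x)\quad\text{for all } y\in\mathcal{X}.$$ Define the constant $\mu:=2\sqrt{L(5L\eta+4)}$. Let $\epsilon\ge0$ and let $x^+$ be any point satisfying $f_x(x^+)\leq\inf f_x+\epsilon$. Then the following two error-bounds hold: - (Step-size error-bound) $$\operatorname{dist}(x;S)\leq\mu\sqrt{\epsilon}+(7L\eta+6)\cdot d(x^+,x)$$ whenever $\sqrt{\epsilon}<\frac{\gamma\mu}{12L}$, $d(x^+,x)<\gamma/9$, and $x^+\in\mathbf{B}_{\gamma/3}(x^* )$. - (Model error-bound) $$\operatorname{dist}(x;S)\leq\left(L\sqrt{12\eta}+\frac{2}{\sqrt{3\eta}}\right)\sqrt{f(x)-f_x(x^+)+\epsilon}$$ whenever $f(x)-\inf f_x<\frac{3\eta\gamma^2}{16}$ and $x\in\mathbf{B}_{\gamma/2}(x^* )$.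
   Context: A function on a metric space is called closed if it is lower-semicontinuous. $\mathbf{B}_r(x)$ is the open ball of radius $r$ around $x$ and $\operatorname{dist}(x;S)=\inf_{y\in S}d(x,y)$. The slope of $f$ at a point $\bar x$ with $f(\bar x)$ finite is $|\nabla f|(\bar x):=\limsup_{x\to\bar x,\,x\ne\bar x}\frac{(f(\bar x)-f(x))^+}{d(\bar x,x)}$, where $r^+=\max\{0,r\}$ (it is $0$ if $\bar x$ is isolated); by convention $|\nabla f|(\bar x)=+\infty$ where $f(\bar x)=+\infty$. The inequality $|f_x(y)-f(y)|\le\frac{\eta}{2}d^2(y,x)$ is understood to mean that $f_x(y)$ and $f(y)$ are either both $+\infty$ or both finite and satisfying the inequality. *)

theory Defs
  imports "HOL-Analysis.Analysis"
begin

text \<open>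
  Functions into \<open>\<real> \<union> {+\<infinity>}\<close> are represented as functions into \<^typ>\<open>ereal\<close>
  that never take the value \<open>-\<infinity>\<close>; this is assumed separately from closedness.
\<close>

definition closed_fun :: "('a::metric_space \<Rightarrow> ereal) \<Rightarrow> bool" where
  "closed_fun f \<longleftrightarrow> (\<forall>x. f x \<le> Liminf (at x) f)"

text \<open>
  The isolated case needs its own clause: there \<open>at x\<close> is the trivial filter, whose
  \<^const>\<open>Limsup\<close> in \<^typ>\<open>ereal\<close> is \<open>-\<infinity>\<close>, not 0.
\<close>

definition slope :: "('a::metric_space \<Rightarrow> ereal) \<Rightarrow> 'a \<Rightarrow> ereal" where
  "slope f x =
     (if f x = \<infinity> then \<infinity>
      else if open {x} then 0
      else Limsup (at x) (\<lambda>y. max 0 (f x - f y) / ereal (dist x y)))"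

text \<open>
  The reading of \<open>\<bar>a - b\<bar> \<le> r\<close> for extended reals; it has to be spelled out since
  \<^typ>\<open>ereal\<close> subtraction gives \<open>\<infinity> - \<infinity> = \<infinity>\<close>.
\<close>

definition ereal_diff_le :: "ereal \<Rightarrow> ereal \<Rightarrow> real \<Rightarrow> bool" where
  "ereal_diff_le a b r \<longleftrightarrow>
     (a = \<infinity> \<and> b = \<infinity>) \<or> (\<bar>a\<bar> \<noteq> \<infinity> \<and> \<bar>b\<bar> \<noteq> \<infinity> \<and> \<bar>a - b\<bar> \<le> ereal r)"

end

theory Submission
  imports Defs
begin

text \<open>
  Both bounds apply Ekeland's variational principle to \<open>g = f + (\<eta>/2) d(\<cdot>, x)\<^sup>2\<close>, which majorizes
  \<open>fx\<close>: a point \<open>z\<close> minimizing \<open>g\<close> up to \<open>k \<rho>\<close> has within distance \<open>\<rho>\<close> a point \<open>w\<close> where the slope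
  of \<open>f\<close> is at most \<open>k + \<eta> d(w, x)\<close>, and the slope error bound at \<open>w\<close> controls the distance to \<open>S\<close>.
  For the step-size bound \<open>z = xplus\<close> and \<open>k \<rho> = \<eta> d(xplus, x)\<^sup>2 + \<epsilon>\<close>; for the model bound \<open>z = x\<close>
  and \<open>k \<rho> = f x - inf fx\<close>. In each case \<open>\<rho>\<close> balances the terms.
\<close>

section \<open>Lower semicontinuity in terms of real thresholds\<close>

text \<open>The point \<open>x\<close> itself satisfies every strict bound in question, so
  \<open>at x\<close> can be traded for \<open>nhds x\<close>; real thresholds suffice because they
  are dense in the extended reals.\<close>

lemma closed_fun_iff:
  "closed_fun f \<longleftrightarrow> (\<forall>x t. ereal t < f x \<longrightarrow> (\<forall>\<^sub>F y in nhds x. ereal t < f y))"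
proof -
  have "f x \<le> Liminf (at x) f \<longleftrightarrow> (\<forall>t. ereal t < f x \<longrightarrow> (\<forall>\<^sub>F y in nhds x. ereal t < f y))" for x
  proof
    assume le: "f x \<le> Liminf (at x) f"
    show "\<forall>t. ereal t < f x \<longrightarrow> (\<forall>\<^sub>F y in nhds x. ereal t < f y)"
    proof (intro allI impI)
      fix t assume t: "ereal t < f x"
      then have "\<forall>\<^sub>F y in at x. ereal t < f y"
        using le by (simp add: le_Liminf_iff)
      then show "\<forall>\<^sub>F y in nhds x. ereal t < f y"
        unfolding eventually_at_filter by (rule eventually_mono) (use t in auto)
    qed
  next
    assume ev: "\<forall>t. ereal t < f x \<longrightarrow> (\<forall>\<^sub>F y in nhds x. ereal t < f y)"
    show "f x \<le> Liminf (at x) f"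
      unfolding le_Liminf_iff
    proof (intro allI impI)
      fix c assume "c < f x"
      then obtain t where t: "c < ereal t" "ereal t < f x"
        using ereal_dense2 by blast
      then have "\<forall>\<^sub>F y in nhds x. ereal t < f y"
        using ev by blast
      then have "\<forall>\<^sub>F y in nhds x. c < f y"
        by (rule eventually_mono) (use t in auto)
      then show "\<forall>\<^sub>F y in at x. c < f y"
        unfolding eventually_at_filter by (rule eventually_mono) simp
    qed
  qed
  then show ?thesis by (simp add: closed_fun_def)
qed

text \<open>A real \<open>s\<close> strictly between \<open>t - h x\<close> and \<open>f x\<close>
  splits the threshold: near \<open>x\<close>, \<open>f\<close> stays above \<open>s\<close> and
  \<open>h\<close> above \<open>t - s\<close>.\<close>

lemma closed_fun_add_continuous:
  fixes f :: "'a::metric_space \<Rightarrow> ereal" and h :: "'a \<Rightarrow> real"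
  assumes f: "closed_fun f" and h: "continuous_on UNIV h"
  shows "closed_fun (\<lambda>y. f y + ereal (h y))"
  unfolding closed_fun_iff
proof (intro allI impI)
  fix x t assume "ereal t < f x + ereal (h x)"
  then have "ereal (t - h x) < f x" by (cases "f x") auto
  then obtain s where s: "ereal (t - h x) < ereal s" "ereal s < f x"
    using ereal_dense2 by blast
  have "\<forall>\<^sub>F y in nhds x. ereal s < f y"
    using f s(2) closed_fun_iff by blast
  moreover have "\<forall>\<^sub>F y in nhds x. t - s < h y"
  proof -
    have "(h \<longlongrightarrow> h x) (nhds x)"
      using h continuous_on_eq_continuous_at[of UNIV h] by (simp add: tendsto_at_iff_tendsto_nhds isCont_def)
    then show ?thesis using s(1) by (simp add: order_tendsto_iff)
  qed
  ultimately show "\<forall>\<^sub>F y in nhds x. ereal t < f y + ereal (h y)"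
  proof eventually_elim
    case (elim y)
    then show ?case by (cases "f y") auto
  qed
qed

lemma closed_fun_closed_sublevel:
  assumes "closed_fun f"
  shows "closed {y. f y \<le> ereal c}"
proof -
  have "open {y. ereal c < f y}"
    using assms unfolding closed_fun_iff open_subopen[of "{y. ereal c < f y}"] eventually_nhds
    by (simp add: subset_eq)
  then show ?thesis by (simp add: closed_def Compl_eq not_le)
qed

section \<open>Ekeland's variational principle\<close>

text \<open>The sets \<open>T u\<close> are the lower sections of a partial order on the points
  where \<open>g\<close> is finite. Moving repeatedly to a nearly lowest point of the current
  section yields nested closed sets of vanishing diameter; their common point \<open>w\<close> is
  minimal for the order.\<close>

theorem ekeland_variational_principle:
  fixes g :: "'a::complete_space \<Rightarrow> ereal"
  assumes g: "closed_fun g" and below: "\<And>y. ereal b \<le> g y" and z: "g z \<noteq> \<infinity>" and k: "k > 0"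
  obtains w where "g w + ereal (k * dist z w) \<le> g z"
    and "\<And>y. y \<noteq> w \<Longrightarrow> g w < g y + ereal (k * dist w y)"
proof -
  \<comment> \<open>\<open>r\<close> is 0 where \<open>g\<close> is infinite, so facts about
    \<open>r\<close> carry a finiteness condition.\<close>
  define r where "r y = real_of_ereal (g y)" for y
  define T where "T u = {y. g y + ereal (k * dist u y) \<le> g u}" for u
  have g_r: "g y = ereal (r y)" if "g y \<noteq> \<infinity>" for y
    using that below[of y] by (cases "g y") (auto simp: r_def)
  have T_iff: "y \<in> T u \<longleftrightarrow> g y \<noteq> \<infinity> \<and> r y + k * dist u y \<le> r u" if "g u \<noteq> \<infinity>" for u y
    using g_r[OF that] g_r[of y] by (cases "g y = \<infinity>") (auto simp: T_def)
  have T_fin: "g y \<noteq> \<infinity>" if "g u \<noteq> \<infinity>" "y \<in> T u" for u y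
    using T_iff that by blast
  have T_refl: "u \<in> T u" if "g u \<noteq> \<infinity>" for u
    using that by (simp add: T_iff)
  have T_trans: "T v \<subseteq> T u" if u: "g u \<noteq> \<infinity>" and v: "v \<in> T u" for u v
  proof
    fix y assume y: "y \<in> T v"
    have "k * dist u y \<le> k * dist u v + k * dist v y"
      using k dist_triangle[of u y v] by (simp flip: distrib_left)
    then show "y \<in> T u"
      using u v y T_fin[OF u v] by (auto simp: T_iff)
  qed
  have T_closed: "closed (T u)" if "g u \<noteq> \<infinity>" for u
  proof -
    have "closed_fun (\<lambda>y. g y + ereal (k * dist u y))"
      by (intro closed_fun_add_continuous g continuous_intros)
    from closed_fun_closed_sublevel[OF this, of "r u"] show ?thesis
      by (simp add: T_def g_r[OF that])
  qed
  define m where "m u = (INF y\<in>T u. r y)" for u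
  have r_below: "b \<le> r y" if "g y \<noteq> \<infinity>" for y
    using below[of y] g_r[OF that] by simp
  have bdd: "bdd_below (r ` T u)" if "g u \<noteq> \<infinity>" for u
    using r_below T_fin[OF that] by (intro bdd_belowI2) blast
  have m_le: "m u \<le> r y" if "g u \<noteq> \<infinity>" "y \<in> T u" for u y
    unfolding m_def using bdd that by (intro cINF_lower) auto
  \<comment> \<open>The successor closes at least half of the gap between \<open>r u\<close> and the
    infimum \<open>m u\<close>; if there is no gap, \<open>u\<close> succeeds itself.\<close>
  have ex: "\<exists>v. v \<in> T u \<and> 2 * r v \<le> r u + m u" if u: "g u \<noteq> \<infinity>" for u
  proof (cases "m u < r u")
    case True
    then have "m u < (r u + m u) / 2" by simp
    then obtain v where "v \<in> T u" "r v < (r u + m u) / 2"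
      unfolding m_def using cINF_less_iff[OF _ bdd[OF u]] T_refl[OF u] by blast
    then show ?thesis by (intro exI[of _ v]) simp
  next
    case False
    then show ?thesis using T_refl[OF u] by (intro exI[of _ u]) simp
  qed
  define nxt where "nxt u = (SOME v. v \<in> T u \<and> 2 * r v \<le> r u + m u)" for u
  have nxt: "nxt u \<in> T u" "2 * r (nxt u) \<le> r u + m u" if "g u \<noteq> \<infinity>" for u
    using someI_ex[OF ex[OF that]] by (auto simp: nxt_def)
  define X where "X n = (nxt ^^ n) z" for n
  have X_Suc: "X (Suc n) = nxt (X n)" for n by (simp add: X_def)
  have X_fin: "g (X n) \<noteq> \<infinity>" for n
    by (induction n) (use z nxt(1) T_fin in \<open>auto simp: X_Suc X_def\<close>)
  have dec: "T (X n) \<subseteq> T (X i)" if "i \<le> n" for i n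
    using that by (induction n rule: dec_induct) (use T_trans X_fin nxt(1) in \<open>force simp: X_Suc\<close>)+
  define C where "C = r z - m z"
  \<comment> \<open>Passing to a smaller section can only raise the infimum, so the gap halves at
    each step.\<close>
  have gap: "r (X n) - m (X n) \<le> C / 2 ^ n" for n
  proof (induction n)
    case 0
    show ?case by (simp add: X_def C_def)
  next
    case (Suc n)
    have "m (X n) \<le> m (X (Suc n))"
      unfolding m_def[of "X (Suc n)"]
      using T_refl[OF X_fin, of "Suc n"] m_le[OF X_fin] dec[of n "Suc n"] by (intro cINF_greatest) auto
    then have "r (X (Suc n)) - m (X (Suc n)) \<le> (r (X n) - m (X n)) / 2"
      using nxt(2)[OF X_fin[of n]] by (simp add: X_Suc)
    also have "\<dots> \<le> C / 2 ^ n / 2"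
      using Suc by (intro divide_right_mono) auto
    finally show ?case by (simp add: field_simps)
  qed
  \<comment> \<open>Membership in \<open>T (X n)\<close> bounds \<open>k * dist (X n) v\<close> by
    the drop of \<open>r\<close>, which is at most the gap.\<close>
  have near: "k * dist (X n) v \<le> C / 2 ^ n" if "v \<in> T (X n)" for n v
    using that gap[of n] m_le[OF X_fin that] by (auto simp: T_iff[OF X_fin])
  have small: "\<exists>n. \<forall>v\<in>T (X n). \<forall>y\<in>T (X n). dist v y < e" if e: "e > 0" for e
  proof -
    have "(\<lambda>n. 2 * C / k * (1 / 2) ^ n) \<longlonglongrightarrow> 2 * C / k * 0"
      by (intro tendsto_intros) simp
    then have "\<forall>\<^sub>F n in sequentially. 2 * C / k * (1 / 2) ^ n < e"
      using e by (auto simp: order_tendsto_iff)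
    then obtain n where n: "2 * C / k * (1 / 2) ^ n < e"
      using eventually_happens' trivial_limit_sequentially by blast
    have "dist v y < e" if "v \<in> T (X n)" "y \<in> T (X n)" for v y
    proof -
      have "k * dist v y \<le> k * dist (X n) v + k * dist (X n) y"
        using k dist_triangle3[of v y "X n"] by (simp flip: distrib_left)
      also have "\<dots> \<le> 2 * (C / 2 ^ n)" using near that by (smt (verit))
      also have "\<dots> < k * e" using n k by (simp add: field_simps power_one_over)
      finally show ?thesis using k by simp
    qed
    then show ?thesis by blast
  qed
  \<comment> \<open>Completeness enters here, through Cantor's intersection theorem.\<close>
  obtain w where w: "\<And>n. w \<in> T (X n)"
    using decreasing_closed_nest[of "\<lambda>n. T (X n)"] T_closed X_fin T_refl dec small by blast
  have w_fin: "g w \<noteq> \<infinity>" using T_fin[OF X_fin w] .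
  \<comment> \<open>By transitivity \<open>y\<close> lies in every \<open>T (X n)\<close> together
    with \<open>w\<close>, and the diameters tend to 0.\<close>
  have "y = w" if "y \<in> T w" for y
  proof (rule ccontr)
    assume "y \<noteq> w"
    then obtain n where "\<forall>v\<in>T (X n). \<forall>y'\<in>T (X n). dist v y' < dist y w"
      using small[of "dist y w"] by auto
    moreover have "y \<in> T (X n)" using T_trans[OF X_fin w] that by blast
    ultimately show False using w by blast
  qed
  then have "g w < g y + ereal (k * dist w y)" if "y \<noteq> w" for y
    using that unfolding T_def by (metis mem_Collect_eq not_le)
  moreover have "g w + ereal (k * dist z w) \<le> g z"
    using w[of 0] by (simp add: T_def X_def)
  ultimately show thesis using that by blast
qed

section \<open>From almost minimizers to the distance to \<open>S\<close>\<close>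

text \<open>Minimality bounds each difference quotient of \<open>f\<close> at \<open>w\<close> by
  \<open>k\<close> plus the growth rate of the quadratic term, and that rate tends to
  \<open>\<eta> * dist w x\<close>.\<close>

lemma slope_le_of_perturbed_min:
  fixes f :: "'a::metric_space \<Rightarrow> ereal"
  assumes f: "\<And>y. f y \<noteq> -\<infinity>" and w: "f w \<noteq> \<infinity>" and "\<eta> \<ge> 0" "k \<ge> 0"
    and min: "\<And>y. f w + ereal (\<eta> / 2 * (dist w x)\<^sup>2)
                   \<le> f y + ereal (\<eta> / 2 * (dist y x)\<^sup>2) + ereal (k * dist w y)"
  shows "slope f w \<le> ereal (k + \<eta> * dist w x)"
proof (cases "open {w}")
  case True
  then show ?thesis using w assms(3,4) by (simp add: slope_def)
next
  case False
  obtain c where c: "f w = ereal c" using f[of w] w by (cases "f w") auto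
  \<comment> \<open>The triangle inequality gives \<open>dist y x \<le> dist w y + dist w x\<close>;
    squaring, multiplying by \<open>\<eta> / 2\<close> and dividing by \<open>dist w y\<close>
    produces the last two terms.\<close>
  let ?B = "\<lambda>y. k + \<eta> * dist w x + \<eta> / 2 * dist w y"
  have quot: "max 0 (f w - f y) / ereal (dist w y) \<le> ereal (?B y)" if "y \<noteq> w" for y
  proof (cases "f y")
    case (real a)
    have "(dist y x)\<^sup>2 - (dist w x)\<^sup>2 \<le> dist w y * (2 * dist w x + dist w y)"
    proof -
      have "(dist y x)\<^sup>2 \<le> (dist w y + dist w x)\<^sup>2"
        using dist_triangle3[of y x w] by (intro power_mono) auto
      then show ?thesis by (simp add: power2_eq_square algebra_simps)
    qed
    then have "\<eta> / 2 * ((dist y x)\<^sup>2 - (dist w x)\<^sup>2) \<le> \<eta> / 2 * (dist w y * (2 * dist w x + dist w y))"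
      using \<open>\<eta> \<ge> 0\<close> by (intro mult_left_mono) auto
    moreover have "c - a \<le> \<eta> / 2 * ((dist y x)\<^sup>2 - (dist w x)\<^sup>2) + k * dist w y"
      using min[of y] c real by (simp add: algebra_simps)
    ultimately have "c - a \<le> ?B y * dist w y"
      by (simp add: algebra_simps)
    moreover have "0 \<le> ?B y * dist w y"
      using assms(3,4) by (intro mult_nonneg_nonneg add_nonneg_nonneg) auto
    ultimately have "max 0 (c - a) / dist w y \<le> ?B y"
      using that by (subst pos_divide_le_eq) auto
    moreover have "max 0 (f w - f y) / ereal (dist w y) = ereal (max 0 (c - a) / dist w y)"
      using c real that by (simp add: max_def zero_ereal_def)
    ultimately show ?thesis by simp
  next
    case PInf
    then show ?thesis using c assms(3,4) that by (simp add: max_def)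
  next
    case MInf
    then show ?thesis using f by blast
  qed
  have "Limsup (at w) (\<lambda>y. max 0 (f w - f y) / ereal (dist w y)) \<le> Limsup (at w) (\<lambda>y. ereal (?B y))"
    by (intro Limsup_mono, unfold eventually_at_filter, intro always_eventually) (use quot in blast)
  also have "((\<lambda>y. ereal (?B y)) \<longlongrightarrow> ereal (k + \<eta> * dist w x + \<eta> / 2 * dist w w)) (at w)"
    by (intro tendsto_intros)
  \<comment> \<open>Since \<open>w\<close> is not isolated, \<open>at w\<close> is nontrivial and
    the upper limit equals the limit.\<close>
  then have "Limsup (at w) (\<lambda>y. ereal (?B y)) = ereal (k + \<eta> * dist w x)"
    using False by (intro lim_imp_Limsup) (auto simp: at_eq_bot_iff)
  finally show ?thesis using False w by (simp add: slope_def)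
qed

text \<open>The case \<open>k = 0\<close> covers exact minimizers, where the nearby point is \<open>z\<close> itself.\<close>

lemma infdist_le_of_almost_min:
  fixes f :: "'a::complete_space \<Rightarrow> ereal"
  assumes f: "\<And>y. f y \<noteq> -\<infinity>" "closed_fun f" and z: "f z \<noteq> \<infinity>"
    and nonneg: "\<eta> \<ge> 0" "k \<ge> 0" "\<rho> \<ge> 0" "L \<ge> 0"
    and almost: "\<And>y. f z + ereal (\<eta> / 2 * (dist z x)\<^sup>2)
                   \<le> f y + ereal (\<eta> / 2 * (dist y x)\<^sup>2) + ereal (k * \<rho>)"
    and error_bound: "\<And>u. u \<in> ball xstar \<gamma> \<Longrightarrow> ereal (infdist u S) \<le> ereal L * slope f u"
    and room: "dist xstar z + \<rho> < \<gamma>"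
  shows "infdist z S \<le> \<rho> + L * (k + \<eta> * (dist z x + \<rho>))"
proof -
  let ?g = "\<lambda>y. f y + ereal (\<eta> / 2 * (dist y x)\<^sup>2)"
  obtain c where c: "f z = ereal c" using f(1)[of z] z by (cases "f z") auto
  define b where "b = c + \<eta> / 2 * (dist z x)\<^sup>2 - k * \<rho>"
  have below: "ereal b \<le> ?g y" for y
    using almost[of y] c by (cases "f y") (auto simp: b_def)
  obtain w where near: "dist z w \<le> \<rho>" and fin: "f w \<noteq> \<infinity>"
    and min: "\<And>y. ?g w \<le> ?g y + ereal (k * dist w y)"
  proof (cases "k = 0")
    case True
    then show thesis using that[of z] almost nonneg z by simp
  next
    case False
    then have k: "k > 0" using nonneg by simp
    have "closed_fun ?g"
      by (intro closed_fun_add_continuous f continuous_intros)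
    then obtain w where w: "?g w + ereal (k * dist z w) \<le> ?g z"
      "\<And>y. y \<noteq> w \<Longrightarrow> ?g w < ?g y + ereal (k * dist w y)"
      using ekeland_variational_principle[of ?g b z k] below z k by auto
    obtain a where a: "f w = ereal a" using w(1) c f(1)[of w] by (cases "f w") auto
    \<comment> \<open>The decrease of \<open>?g\<close> from \<open>z\<close> to \<open>w\<close> is
      at most its value at \<open>z\<close> minus the lower bound \<open>b\<close>, which is
      \<open>k * \<rho>\<close>.\<close>
    have "k * dist z w \<le> k * \<rho>"
      using w(1) below[of w] a c by (simp add: b_def)
    then have "dist z w \<le> \<rho>" using k by simp
    moreover have "?g w \<le> ?g y + ereal (k * dist w y)" for y
      using w(2)[of y] by (cases "y = w") auto
    ultimately show thesis using that[of w] a by simp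
  qed
  have "w \<in> ball xstar \<gamma>"
    using room near dist_triangle[of xstar w z] by simp
  then have "ereal (infdist w S) \<le> ereal L * slope f w" by (rule error_bound)
  also have "\<dots> \<le> ereal L * ereal (k + \<eta> * dist w x)"
    using nonneg f fin min by (intro ereal_mult_left_mono slope_le_of_perturbed_min) auto
  finally have "infdist w S \<le> L * (k + \<eta> * dist w x)" by simp
  also have "\<dots> \<le> L * (k + \<eta> * (dist z x + \<rho>))"
    using nonneg near dist_triangle3[of w x z]
    by (intro mult_left_mono add_left_mono) auto
  finally show ?thesis using infdist_triangle[of z S w] near by simp
qed

lemma ereal_diff_leD:
  assumes "ereal_diff_le a b r"
  shows "a \<le> b + ereal r" "b \<le> a + ereal r"
  using assms by (cases a; cases b; simp add: ereal_diff_le_def)+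

section \<open>The step-size and model error bounds\<close>

theorem corollary5p8:
  fixes f fx :: "'a::complete_space \<Rightarrow> ereal"
    and x xstar xplus :: 'a
    and S :: "'a set"
    and L \<gamma> \<eta> \<mu> \<epsilon> :: real
  assumes "\<forall>y. f y \<noteq> -\<infinity>" and "closed_fun f"
    and "\<bar>f x\<bar> \<noteq> \<infinity>"
    and "xstar \<in> S"
    and "L > 0" and "\<gamma> > 0"
    and error_bound: "\<forall>u \<in> ball xstar \<gamma>. ereal (infdist u S) \<le> ereal L * slope f u"
    and "\<forall>y. fx y \<noteq> -\<infinity>" and "closed_fun fx"
    and "\<eta> > 0"
    and model: "\<forall>y. ereal_diff_le (fx y) (f y) (\<eta> / 2 * (dist y x)\<^sup>2)"
    and \<mu>_def: "\<mu> = 2 * sqrt (L * (5 * L * \<eta> + 4))"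
    and "\<epsilon> \<ge> 0"
    and xplus: "fx xplus \<le> (INF y. fx y) + ereal \<epsilon>"
  shows
    "(sqrt \<epsilon> < \<gamma> * \<mu> / (12 * L) \<and> dist xplus x < \<gamma> / 9 \<and> xplus \<in> ball xstar (\<gamma> / 3) \<longrightarrow>
        infdist x S \<le> \<mu> * sqrt \<epsilon> + (7 * L * \<eta> + 6) * dist xplus x)
   \<and> (f x - (INF y. fx y) < ereal (3 * \<eta> * \<gamma>\<^sup>2 / 16) \<and> x \<in> ball xstar (\<gamma> / 2) \<longrightarrow>
        infdist x S \<le> (L * sqrt (12 * \<eta>) + 2 / sqrt (3 * \<eta>))
          * sqrt (real_of_ereal (f x - fx xplus + ereal \<epsilon>)))"
proof -
  obtain c where c: "f x = ereal c" using \<open>\<bar>f x\<bar> \<noteq> \<infinity>\<close> by (cases "f x") auto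
  have fx_le: "fx y \<le> f y + ereal (\<eta> / 2 * (dist y x)\<^sup>2)"
    and f_le: "f y \<le> fx y + ereal (\<eta> / 2 * (dist y x)\<^sup>2)" for y
    using ereal_diff_leD[OF model[rule_format]] by blast+
  \<comment> \<open>The model is exact at its center, where the quadratic error vanishes.\<close>
  have fx_x: "fx x = ereal c"
    using fx_le[of x] f_le[of x] c by (simp add: order_antisym)
  have "(INF y. fx y) \<noteq> -\<infinity>"
    using xplus \<open>\<forall>y. fx y \<noteq> -\<infinity>\<close>[rule_format, of xplus] by auto
  moreover have "(INF y. fx y) \<le> ereal c"
    using INF_lower[of x UNIV fx] fx_x by simp
  ultimately obtain m where m: "(INF y. fx y) = ereal m"
    by (cases "INF y. fx y") auto
  have m_le_fx: "ereal m \<le> fx y" for y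
    using INF_lower[of y UNIV fx] m by simp
  have m_le: "ereal m \<le> f y + ereal (\<eta> / 2 * (dist y x)\<^sup>2)" for y
    using m_le_fx fx_le by (rule order_trans)
  obtain p where p: "fx xplus = ereal p" "p \<le> m + \<epsilon>"
    using xplus m m_le_fx[of xplus] by (cases "fx xplus") auto
  obtain q where q: "f xplus = ereal q" "q \<le> p + \<eta> / 2 * (dist xplus x)\<^sup>2"
    using f_le[of xplus] p(1) \<open>\<forall>y. f y \<noteq> -\<infinity>\<close> by (cases "f xplus") auto
  note transfer = infdist_le_of_almost_min[of f _ \<eta> _ _ L x xstar \<gamma> S]
  have step: "infdist x S \<le> \<mu> * sqrt \<epsilon> + (7 * L * \<eta> + 6) * dist xplus x"
    if "sqrt \<epsilon> < \<gamma> * \<mu> / (12 * L)" "dist xplus x < \<gamma> / 9" "xplus \<in> ball xstar (\<gamma> / 3)"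
  proof -
    define D where "D = dist xplus x"
    define A where "A = 1 + L * \<eta>"
    define s where "s = sqrt \<epsilon>"
    define t where "t = sqrt (L / A)"
    \<comment> \<open>The bound to come is \<open>A * D + A * \<rho> + L * k\<close>. Its part
      \<open>A * \<rho> + L * \<epsilon> / \<rho>\<close> is least at \<open>\<rho> = t * s\<close>;
      the summand \<open>D\<close> keeps \<open>\<eta> * D\<^sup>2 / \<rho>\<close> below
      \<open>\<eta> * D\<close>.\<close>
    define \<rho> where "\<rho> = D + t * s"
    define k where "k = (\<eta> * D\<^sup>2 + \<epsilon>) / \<rho>"
    have A: "A > 1" using assms(5,10) by (simp add: A_def)
    have t: "t > 0" "t\<^sup>2 = L / A" using A \<open>L > 0\<close> by (auto simp: t_def)
    have s: "s \<ge> 0" "s\<^sup>2 = \<epsilon>" using \<open>\<epsilon> \<ge> 0\<close> by (auto simp: s_def)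
    have D: "D \<ge> 0" by (simp add: D_def)
    have \<rho>: "\<rho> \<ge> 0" using D t s by (simp add: \<rho>_def)
    have k: "k \<ge> 0" using \<rho> \<open>\<eta> > 0\<close> \<open>\<epsilon> \<ge> 0\<close> by (simp add: k_def)
    \<comment> \<open>If \<open>\<rho> = 0\<close>, division by zero makes \<open>k\<close> zero,
      but then \<open>D\<close> and \<open>\<epsilon>\<close> vanish too.\<close>
    have k\<rho>: "k * \<rho> = \<eta> * D\<^sup>2 + \<epsilon>"
    proof (cases "\<rho> = 0")
      case True
      then have "D = 0" "t * s = 0"
        using D t s mult_nonneg_nonneg[of t s] by (auto simp: \<rho>_def add_nonneg_eq_0_iff)
      then show ?thesis using True t s by auto
    qed (simp add: k_def)
    have At: "A * t = sqrt (L * A)"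
      using A \<open>L > 0\<close> by (simp add: t_def real_sqrt_divide real_sqrt_mult field_simps)
    \<comment> \<open>The lower bound on \<open>\<mu>\<close> serves the final estimate; the upper
      bound turns the smallness of \<open>sqrt \<epsilon>\<close> into smallness of
      \<open>\<rho>\<close>.\<close>
    have \<mu>_ge: "2 * (A * t) \<le> \<mu>"
      unfolding \<mu>_def At using assms(5,10) by (simp add: A_def)
    have \<mu>_le: "\<mu> \<le> 5 * (A * t)"
    proof -
      have "sqrt (L * (5 * L * \<eta> + 4)) \<le> sqrt ((5/2)\<^sup>2 * (L * A))"
        using assms(5,10) by (simp add: A_def field_simps power2_eq_square)
      then show ?thesis by (simp add: \<mu>_def At real_sqrt_mult)
    qed
    have "t * s \<le> 5 / 12 * \<gamma>"
    proof -
      have "t * s \<le> t * (\<gamma> * \<mu> / (12 * L))"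
        using that(1) t by (intro mult_left_mono) (auto simp: s_def)
      also have "\<dots> \<le> t * (\<gamma> * (5 * (A * t)) / (12 * L))"
        using \<mu>_le t \<open>\<gamma> > 0\<close> \<open>L > 0\<close>
        by (intro mult_left_mono divide_right_mono) auto
      also have "\<dots> = 5 / 12 * \<gamma> * (A * t\<^sup>2 / L)"
        by (simp add: power2_eq_square)
      also have "\<dots> = 5 / 12 * \<gamma>" using t A \<open>L > 0\<close> by simp
      finally show ?thesis .
    qed
    \<comment> \<open>The fractions of \<open>\<gamma>\<close> add up to 1/3 + 1/9 + 5/12 =
      31/36.\<close>
    then have room: "dist xstar xplus + \<rho> < \<gamma>"
      using that(2,3) \<open>\<gamma> > 0\<close> by (simp add: \<rho>_def D_def)
    \<comment> \<open>One half of \<open>\<eta> * D\<^sup>2\<close> is the model error at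
      \<open>xplus\<close>, the other half the quadratic term there.\<close>
    have almost: "f xplus + ereal (\<eta> / 2 * (dist xplus x)\<^sup>2)
        \<le> f y + ereal (\<eta> / 2 * (dist y x)\<^sup>2) + ereal (k * \<rho>)" for y
      using m_le[of y] p q k\<rho> by (cases "f y") (auto simp: D_def)
    have "infdist xplus S \<le> \<rho> + L * (k + \<eta> * (D + \<rho>))"
      unfolding D_def
      using assms room almost q \<rho> k by (intro transfer) auto
    then have "infdist x S \<le> D + \<rho> + L * (k + \<eta> * (D + \<rho>))"
      using infdist_triangle[of x S xplus] by (simp add: D_def dist_commute)
    \<comment> \<open>The two pieces of \<open>k\<close> are compared using
      \<open>\<rho> \<ge> D\<close> and \<open>\<rho> \<ge> t * s\<close>, with
      \<open>A * t\<^sup>2 = L\<close>. Clearing the denominator \<open>\<rho>\<close> avoids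
      dividing by \<open>D\<close> or \<open>t * s\<close>, either of which may be 0.\<close>
    also have "k \<le> \<eta> * D + A * t * s / L"
    proof (cases "\<rho> = 0")
      case True
      then show ?thesis using assms(5,10) D A t s by (simp add: k_def)
    next
      case False
      have "A * t * s / L * (t * s) = \<epsilon>"
      proof -
        have "A * t * s / L * (t * s) = A * t\<^sup>2 / L * s\<^sup>2" by (simp add: power2_eq_square)
        then show ?thesis using t s A \<open>L > 0\<close> by simp
      qed
      moreover have "0 \<le> \<eta> * D * (t * s)" "0 \<le> A * t * s / L * D"
        using assms(5,10) D A t s by auto
      ultimately have "\<eta> * D\<^sup>2 + \<epsilon> \<le> (\<eta> * D + A * t * s / L) * \<rho>"
        by (simp add: \<rho>_def distrib_left distrib_right power2_eq_square mult.assoc)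
      then show ?thesis using False \<rho> by (simp add: k_def pos_divide_le_eq)
    qed
    then have "D + \<rho> + L * (k + \<eta> * (D + \<rho>))
        \<le> D + \<rho> + L * ((\<eta> * D + A * t * s / L) + \<eta> * (D + \<rho>))"
      using \<open>L > 0\<close> by (intro add_left_mono mult_left_mono add_right_mono) auto
    also have "\<dots> = 2 * (A * t) * s + (3 * L * \<eta> + 2) * D"
      using \<open>L > 0\<close> by (simp add: \<rho>_def A_def field_simps)
    also have "\<dots> \<le> \<mu> * s + (7 * L * \<eta> + 6) * D"
      using \<mu>_ge s D assms(5,10) by (intro add_mono mult_right_mono) auto
    finally show ?thesis by (simp add: s_def D_def)
  qed
  have model_bound: "infdist x S \<le> (L * sqrt (12 * \<eta>) + 2 / sqrt (3 * \<eta>))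
          * sqrt (real_of_ereal (f x - fx xplus + ereal \<epsilon>))"
    if "f x - (INF y. fx y) < ereal (3 * \<eta> * \<gamma>\<^sup>2 / 16)" "x \<in> ball xstar (\<gamma> / 2)"
  proof -
    define \<Delta> where "\<Delta> = c - m"
    define s where "s = sqrt \<Delta>"
    define a where "a = sqrt (3 * \<eta>)"
    \<comment> \<open>This radius yields the coefficient \<open>2 / a\<close> of the claim, and the
      hypothesis \<open>\<Delta> < (a * \<gamma> / 4)\<^sup>2\<close> says exactly that
      \<open>\<rho> < \<gamma> / 2\<close>.\<close>
    define \<rho> where "\<rho> = 2 * s / a"
    define k where "k = a * s / 2"
    have \<Delta>: "\<Delta> \<ge> 0" "\<Delta> < 3 * \<eta> * \<gamma>\<^sup>2 / 16"
      using m_le_fx[of x] fx_x that(1) c m by (auto simp: \<Delta>_def)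
    have s: "s \<ge> 0" "s\<^sup>2 = \<Delta>" using \<Delta> by (auto simp: s_def)
    have a: "a > 0" "a\<^sup>2 = 3 * \<eta>" using \<open>\<eta> > 0\<close> by (auto simp: a_def)
    have \<rho>: "\<rho> \<ge> 0" and k: "k \<ge> 0" using s a by (auto simp: \<rho>_def k_def)
    have k\<rho>: "k * \<rho> = \<Delta>" using s a by (simp add: k_def \<rho>_def power2_eq_square)
    have "s < a * \<gamma> / 4"
    proof -
      have "s\<^sup>2 < (a * \<gamma> / 4)\<^sup>2" using \<Delta>(2) s a by (simp add: power_mult_distrib power_divide)
      then show ?thesis by (rule power2_less_imp_less) (use a \<open>\<gamma> > 0\<close> in auto)
    qed
    then have "\<rho> < \<gamma> / 2" using a by (simp add: \<rho>_def field_simps)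
    then have room: "dist xstar x + \<rho> < \<gamma>" using that(2) by simp
    have almost: "f x + ereal (\<eta> / 2 * (dist x x)\<^sup>2)
        \<le> f y + ereal (\<eta> / 2 * (dist y x)\<^sup>2) + ereal (k * \<rho>)" for y
      using m_le[of y] c k\<rho> by (cases "f y") (auto simp: \<Delta>_def)
    have "infdist x S \<le> \<rho> + L * (k + \<eta> * (dist x x + \<rho>))"
      using assms room almost c \<rho> k by (intro transfer) auto
    also have "\<dots> = \<rho> + L * (k + \<eta> * \<rho>)" by simp
    also have "\<eta> * \<rho> = 2 / 3 * a * s"
    proof -
      have "\<eta> = a * a / 3" using a(2) by (simp add: power2_eq_square)
      then show ?thesis by (rule ssubst) (use a(1) in \<open>simp add: \<rho>_def\<close>)
    qed
    \<comment> \<open>The factor 7/6 is 1/2 from \<open>k\<close> plus 2/3 from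
      \<open>\<eta> * \<rho>\<close>; it is then relaxed to 2.\<close>
    also have "\<rho> + L * (k + 2 / 3 * a * s) = (L * (7 / 6 * a) + 2 / a) * s"
      by (simp add: \<rho>_def k_def algebra_simps)
    also have "\<dots> \<le> (L * (2 * a) + 2 / a) * s"
      using a s \<open>L > 0\<close> by (intro mult_right_mono add_right_mono mult_left_mono) auto
    also have "2 * a = sqrt (12 * \<eta>)"
    proof -
      have "sqrt (12 * \<eta>) = sqrt (2\<^sup>2 * (3 * \<eta>))" by simp
      then show ?thesis by (simp only: real_sqrt_mult a_def) simp
    qed
    \<comment> \<open>Near-optimality \<open>p \<le> m + \<epsilon>\<close> gives
      \<open>\<Delta> \<le> c - p + \<epsilon>\<close>.\<close>
    also have "(L * sqrt (12 * \<eta>) + 2 / a) * s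
        \<le> (L * sqrt (12 * \<eta>) + 2 / a) * sqrt (real_of_ereal (f x - fx xplus + ereal \<epsilon>))"
      using p c a assms(5,10)
      by (intro mult_left_mono) (auto simp: s_def \<Delta>_def)
    finally show ?thesis by (simp add: a_def)
  qed
  show ?thesis using step model_bound by blast
qed

end
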